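(* Let $F=\mathbb{F}_q$, $q=2^r$, and let $(F,+,* )$ be a commutative presemifield with multiplication written uniquely as $x*y=\sum_{i,j=0}^{r-1}a_{ij}x^{2^i}y^{2^j}$. Then the bases $$B_\infty=\{e_w\mid w\in F\},\qquad B_m=\{b_{m,v}\mid v\in F\}\ (m\in F),\qquad b_{m,v}=\frac{1}{\sqrt q}\sum_{w\in F}\omega^{{\rm Tr}(\hat m(\hat w*\hat w)+2\hat w\hat v)}e_w,$$ form a complete set of mutually unbiased bases of $\mathbb{C}^q$.
   Context: $\omega\in\mathbb{C}$ is a primitive $4$th root of unity, $\{e_w\}_{w\in F}$ the standard basis of $\mathbb{C}^q$. A presemifield $(F,+,* )$ is the additive group of $F$ with a multiplication $*$ left and right distributive over $+$ and without zero divisors; commutative means $x*y=y*x$. $R=GR(4^r)$ is the Galois ring of characteristic $4$ and order $4^r$ ($R/2R\cong\mathbb{F}_q$), $\mathcal{T}=\{0\}\cup C$ its Teichmüller set ($C$ the cyclic subgroup of order $2^r-1$ of $R^*$), and $\hat u\in\mathcal{T}$ the Teichmüller lift of $u\in F$. For $x=a+2b$ ($a,b\in\mathcal{T}$), ${\rm Tr}(x)=\sum_{i=0}^{r-1}(a^{2^i}+2b^{2^i})\in\mathbb{Z}_4$. The extension of $*$ is $\hat x*\hat y=\sum_{i,j}\widehat{a_{ij}}\hat x^{2^i}\hat y^{2^j}\in R$. A complete set of MUBs of $\mathbb{C}^q$ is a set of $q+1$ orthonormal bases with $|(x,y)|^2=1/q$ for $x,y$ in distinct bases. *)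

theory Defs
  imports "HOL-Analysis.Analysis" "HOL-Computational_Algebra.Primes"
begin

definition presemifield :: "('f::ab_group_add \<Rightarrow> 'f \<Rightarrow> 'f) \<Rightarrow> bool" where
  "presemifield star \<longleftrightarrow>
     (\<forall>x y z. star x (y + z) = star x y + star x z) \<and>
     (\<forall>x y z. star (x + y) z = star x z + star y z) \<and>
     (\<forall>x y. star x y = 0 \<longrightarrow> x = 0 \<or> y = 0)"

definition commutative_presemifield :: "('f::ab_group_add \<Rightarrow> 'f \<Rightarrow> 'f) \<Rightarrow> bool" where
  "commutative_presemifield star \<longleftrightarrow> presemifield star \<and> (\<forall>x y. star x y = star y x)"

text \<open>
  A Galois ring is a finite commutative ring with identity whose zero divisors, together with 0,
  form the principal ideal generated by the prime below the characteristic; its isomorphism type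
  is determined by the characteristic and the order. Since 0 annihilates 1, the set on
  the left-hand side of the last conjunct contains 0. Finiteness follows from the order.
\<close>

definition galois_ring4 :: "'r::comm_ring_1 itself \<Rightarrow> nat \<Rightarrow> bool" where
  "galois_ring4 _ r \<longleftrightarrow>
     CHAR('r) = 4 \<and> CARD('r) = 4 ^ r \<and>
     {x::'r. \<exists>y. y \<noteq> 0 \<and> x * y = 0} = range (\<lambda>z. 2 * z)"

text \<open>
  A surjective ring homomorphism from \<open>R\<close> to \<open>F\<close> with kernel \<open>2R\<close>, that is, an
  identification of \<open>R/2R\<close> with \<open>F\<close>.
\<close>

definition residue_map :: "('r::comm_ring_1 \<Rightarrow> 'f::field) \<Rightarrow> bool" where
  "residue_map \<rho> \<longleftrightarrow>
     \<rho> 1 = 1 \<and> (\<forall>x y. \<rho> (x + y) = \<rho> x + \<rho> y) \<and> (\<forall>x y. \<rho> (x * y) = \<rho> x * \<rho> y) \<and>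
     surj \<rho> \<and> {x. \<rho> x = 0} = range (\<lambda>z. 2 * z)"

text \<open>
  In a finite ring the powers of a unit with natural exponents already form a group, so the
  sets described below are the cyclic subgroups of order \<open>2\<^sup>r - 1\<close> of the unit group. In
  \<open>GR(4\<^sup>r)\<close> there is exactly one, as the unit group has order \<open>2\<^sup>r (2\<^sup>r - 1)\<close>.
\<close>

definition teich_group :: "nat \<Rightarrow> 'r::comm_ring_1 set" where
  "teich_group r = (THE C. \<exists>\<xi>. \<xi> dvd 1 \<and> C = range (\<lambda>k::nat. \<xi> ^ k) \<and> card C = 2 ^ r - 1)"

definition teich_set :: "nat \<Rightarrow> 'r::comm_ring_1 set" where
  "teich_set r = {0} \<union> teich_group r"

definition teich_lift :: "nat \<Rightarrow> ('r::comm_ring_1 \<Rightarrow> 'f::field) \<Rightarrow> 'f \<Rightarrow> 'r" where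
  "teich_lift r \<rho> u = (THE t. t \<in> teich_set r \<and> \<rho> t = u)"

text \<open>The trace takes its values in the prime subring of \<open>R\<close>, a copy of \<open>\<int>\<^sub>4\<close>.\<close>

definition gr_trace :: "nat \<Rightarrow> 'r::comm_ring_1 \<Rightarrow> 'r" where
  "gr_trace r x =
     (let (a, b) = (THE p. fst p \<in> teich_set r \<and> snd p \<in> teich_set r \<and> x = fst p + 2 * snd p)
      in \<Sum>i<r. a ^ (2 ^ i) + 2 * b ^ (2 ^ i))"

text \<open>The representative in \<open>{0, 1, 2, 3}\<close> of an element of the prime subring.\<close>

definition z4_rep :: "'r::comm_ring_1 \<Rightarrow> nat" where
  "z4_rep z = (THE k. k < 4 \<and> of_nat k = z)"

text \<open>The extension to \<open>R\<close> of the multiplication with coefficients \<open>a\<close>; it is only applied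
  to Teichmueller elements \<open>x\<close> and \<open>y\<close>.\<close>

definition ext_mult ::
  "nat \<Rightarrow> ('r::comm_ring_1 \<Rightarrow> 'f::field) \<Rightarrow> (nat \<Rightarrow> nat \<Rightarrow> 'f) \<Rightarrow> 'r \<Rightarrow> 'r \<Rightarrow> 'r" where
  "ext_mult r \<rho> a x y = (\<Sum>i<r. \<Sum>j<r. teich_lift r \<rho> (a i j) * x ^ (2 ^ i) * y ^ (2 ^ j))"

definition primitive_root_of_unity :: "nat \<Rightarrow> complex \<Rightarrow> bool" where
  "primitive_root_of_unity n \<omega> \<longleftrightarrow> \<omega> ^ n = 1 \<and> (\<forall>k. 0 < k \<and> k < n \<longrightarrow> \<omega> ^ k \<noteq> 1)"

text \<open>The Hermitian inner product; the library's \<open>inner\<close> on this type is its real part.\<close>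

definition cinner :: "complex ^ 'n::finite \<Rightarrow> complex ^ 'n \<Rightarrow> complex" where
  "cinner x y = (\<Sum>i\<in>UNIV. x $ i * cnj (y $ i))"

text \<open>Independence and span are those of the complex vector space, not the underlying real one.\<close>

definition orthonormal_basis :: "(complex ^ 'n::finite) set \<Rightarrow> bool" where
  "orthonormal_basis B \<longleftrightarrow>
     vec.independent B \<and> vec.span B = UNIV \<and>
     (\<forall>x\<in>B. \<forall>y\<in>B. cinner x y = (if x = y then 1 else 0))"

definition complete_mubs :: "(complex ^ 'n::finite) set set \<Rightarrow> bool" where
  "complete_mubs \<B> \<longleftrightarrow>
     card \<B> = CARD('n) + 1 \<and> (\<forall>B\<in>\<B>. orthonormal_basis B) \<and>
     (\<forall>B\<in>\<B>. \<forall>B'\<in>\<B>. B \<noteq> B' \<longrightarrow>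
        (\<forall>x\<in>B. \<forall>y\<in>B'. (cmod (cinner x y))\<^sup>2 = 1 / real CARD('n)))"

definition std_basis :: "(complex ^ 'n::finite) set" where
  "std_basis = range (\<lambda>w. axis w 1)"

definition mub_vec ::
  "nat \<Rightarrow> ('r::comm_ring_1 \<Rightarrow> 'f::finite_field) \<Rightarrow> (nat \<Rightarrow> nat \<Rightarrow> 'f) \<Rightarrow> complex \<Rightarrow>
   'f \<Rightarrow> 'f \<Rightarrow> complex ^ 'f::finite_field" where
  "mub_vec r \<rho> a \<omega> m v =
     complex_of_real (1 / sqrt (real CARD('f))) *s
       (\<Sum>w\<in>UNIV.
          \<omega> ^ z4_rep (gr_trace r
                (teich_lift r \<rho> m * ext_mult r \<rho> a (teich_lift r \<rho> w) (teich_lift r \<rho> w)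
                  + 2 * teich_lift r \<rho> w * teich_lift r \<rho> v))
            *s axis w 1)"

definition mub_basis ::
  "nat \<Rightarrow> ('r::comm_ring_1 \<Rightarrow> 'f::finite_field) \<Rightarrow> (nat \<Rightarrow> nat \<Rightarrow> 'f) \<Rightarrow> complex \<Rightarrow>
   'f \<Rightarrow> (complex ^ 'f::finite_field) set" where
  "mub_basis r \<rho> a \<omega> m = range (mub_vec r \<rho> a \<omega> m)"

end

theory Submission
  imports Defs "HOL-Algebra.Multiplicative_Group" "HOL-Number_Theory.Cong"
begin

text \<open>
  The set \<open>T = {t. t\<^bsup>q\<^esup> = t}\<close> is the Teichmueller set, and \<open>frob i (a + 2 b) = a\<^bsup>2^i\<^esup> + 2 b\<^bsup>2^i\<^esup>\<close>
  (\<open>a\<close>, \<open>b\<close> in \<open>T\<close>) is additive, so \<open>psi x = \<omega>\<^bsup>Tr x\<^esup>\<close> is an additive character of \<open>R\<close> whose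
  restriction to \<open>2R\<close> is a nontrivial character \<open>chi\<close> of \<open>F\<close>. Inner products of vectors from two
  bases are sums of \<open>phi w = psi (D (w * w) + 2 w c)\<close> with \<open>D\<close> the difference of the lifts of \<open>m\<close> and \<open>m'\<close>.
  Commutativity makes \<open>w * w\<close> a quadratic form with values in \<open>R\<close>, whence
  \<open>phi (w + z) = phi w phi z chi (d (w * z))\<close> for the residue \<open>d\<close> of \<open>D\<close>. If \<open>d \<noteq> 0\<close>, then
  \<open>z \<mapsto> d (w * z)\<close> is bijective for every \<open>w \<noteq> 0\<close>, and so in \<open>|\<Sum> phi|\<^sup>2 = \<Sum>w. phi w (\<Sum>z. chi (d (w * z)))\<close>
  only the term \<open>w = 0\<close> survives, which is \<open>q\<close>.
\<close>

section \<open>Finite fields\<close>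

text \<open>The multiplicative group of a finite field is cyclic. That theorem speaks of carrier
  records, so the type class field is repackaged as the record \<open>K\<close>, whose powers agree
  with \<open>^\<close>.\<close>

lemma finite_field_generator:
  obtains g :: "'f::finite_field" where "range (\<lambda>k::nat. g ^ k) = UNIV - {0}"
proof -
  define K :: "'f ring" where
    "K = \<lparr>carrier = UNIV, monoid.mult = (*), one = 1, ring.zero = 0, add = (+)\<rparr>"
  have K: "carrier K = UNIV" "monoid.mult K = (*)" "monoid.one K = 1" "ring.zero K = 0"
    "ring.add K = (+)"
    by (auto simp: K_def)
  have "\<exists>y. y + x = 0" "x \<noteq> 0 \<Longrightarrow> \<exists>y. y * x = 1" for x :: 'f
    by (metis add.left_inverse) (metis left_inverse)
  hence "cring K"
    by (intro cringI abelian_groupI comm_monoidI) (auto simp: K algebra_simps)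
  then interpret cring K .
  have "x \<in> Units K" if "x \<noteq> 0" for x
    using that left_inverse[of x] right_inverse[of x] unfolding Units_def K by blast
  hence "field K"
    by (intro cring_fieldI) (auto simp: K Units_def)
  then interpret K: field K .
  have pow: "x [^]\<^bsub>K\<^esub> (k::nat) = x ^ k" for x k
    by (induction k) (auto simp: K)
  have "finite (carrier K)"
    by simp
  from K.finite_field_mult_group_has_gen[OF this] obtain g
    where "carrier (mult_of K) = {g [^]\<^bsub>K\<^esub> i | i::nat. i \<in> UNIV}"
    by blast
  hence "range (\<lambda>k::nat. g ^ k) = UNIV - {0}"
    unfolding pow by (auto simp: K)
  thus ?thesis
    by (rule that)
qed

text \<open>The degree is at most \<open>2 ^ (r - 1)\<close>, less than the \<open>2 ^ r\<close>
  roots, so the polynomial is zero; the exponents \<open>2 ^ i\<close> are distinct, so each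
  coefficient can be read off.\<close>

lemma linearized_poly_eq_0:
  fixes c :: "nat \<Rightarrow> 'f::finite_field"
  assumes "CARD('f) = 2 ^ r" and "\<And>x. (\<Sum>i<r. c i * x ^ (2 ^ i)) = 0" and "i < r"
  shows "c i = 0"
proof -
  define p where "p = (\<Sum>i<r. Polynomial.monom (c i) (2 ^ i))"
  have "Polynomial.degree p \<le> 2 ^ (r - 1)"
    unfolding p_def
    by (intro degree_sum_le) (auto intro!: order.trans[OF degree_monom_le] power_increasing)
  also have "2 ^ (r - 1) < (2 ^ r :: nat)"
    using \<open>i < r\<close> by (intro power_strict_increasing) auto
  finally have "Polynomial.degree p < card {x. poly p x = 0}"
    using assms(1,2) by (simp add: p_def poly_sum poly_monom)
  hence "p = 0"
    using card_poly_roots_bound[of p] by force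
  hence "0 = poly.coeff p (2 ^ i)"
    by simp
  also have "\<dots> = (\<Sum>j<r. if j = i then c j else 0)"
    unfolding p_def by (simp add: coeff_sum)
  also have "\<dots> = c i"
    using \<open>i < r\<close> by simp
  finally show ?thesis
    by simp
qed

section \<open>Orthonormal bases\<close>

lemma cinner_sum_left: "cinner (\<Sum>x\<in>A. f x) y = (\<Sum>x\<in>A. cinner (f x) y)"
  unfolding cinner_def by (simp add: sum_distrib_right) (rule sum.swap)

lemma cinner_scale_left: "cinner (c *s x) y = c * cinner x y"
  unfolding cinner_def by (simp add: sum_distrib_left mult.assoc)

lemma cinner_commute: "cinner x y = cnj (cinner y x)"
  unfolding cinner_def by (simp add: mult.commute)

lemma cinner_axis_right: "cinner x (axis i 1) = x $ i"
proof -
  have "cinner x (axis i 1) = (\<Sum>j\<in>UNIV. if j = i then x $ j else 0)"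
    unfolding cinner_def by (intro sum.cong) (auto simp: axis_def)
  thus ?thesis
    by simp
qed

text \<open>Pairing a vanishing combination with one of the vectors isolates its coefficient, so the
  family is independent; having as many members as the dimension, it spans.\<close>

lemma orthonormal_basis_range:
  fixes b :: "'n \<Rightarrow> complex ^ 'n::finite"
  assumes b: "\<And>v v'. cinner (b v) (b v') = (if v = v' then 1 else 0)"
  shows "orthonormal_basis (range b)"
proof -
  have "inj b"
    by (rule injI) (metis b zero_neq_one)
  hence card: "card (range b) = CARD('n)"
    by (simp add: card_image)
  have orth: "cinner x y = (if x = y then 1 else 0)" if "x \<in> range b" "y \<in> range b" for x y
    using that b \<open>inj b\<close> by (auto simp: inj_eq)
  have ind: "vec.independent (range b)"
  proof (rule vec.independent_if_scalars_zero)
    fix f x assume 0: "(\<Sum>y\<in>range b. f y *s y) = 0" and x: "x \<in> range b"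
    have "0 = cinner (\<Sum>y\<in>range b. f y *s y) x"
      unfolding 0 by (simp add: cinner_def)
    also have "\<dots> = (\<Sum>y\<in>range b. if y = x then f y else 0)"
      unfolding cinner_sum_left cinner_scale_left using x by (intro sum.cong) (auto simp: orth)
    also have "\<dots> = f x"
      using x by simp
    finally show "f x = 0"
      by simp
  qed simp
  have "vec.span (range b) = UNIV"
    using vec.card_ge_dim_independent[OF subset_UNIV ind] card unfolding vec_dim_card by auto
  with ind orth show ?thesis
    unfolding orthonormal_basis_def by blast
qed

section \<open>Galois rings of characteristic 4\<close>

locale galois_residue =
  fixes r :: nat and \<rho> :: "'r::comm_ring_1 \<Rightarrow> 'f::finite_field"
  assumes card_field: "CARD('f) = 2 ^ r"
    and galois: "galois_ring4 TYPE('r) r"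
    and residue: "residue_map \<rho>"
begin

lemma r_pos: "r > 0"
proof (rule ccontr)
  assume "\<not> r > 0"
  hence "card (UNIV :: 'f set) = 1"
    using card_field by simp
  then obtain x :: 'f where "UNIV = {x}"
    by (rule card_1_singletonE)
  hence "(0::'f) = 1"
    by (metis UNIV_I singletonD)
  thus False
    by simp
qed

lemma q_eq: "2 ^ r = 2 * 2 ^ (r - 1)"
  using r_pos by (simp flip: power_Suc)

lemma finite_ring: "finite (UNIV :: 'r set)"
  using galois by (intro card_ge_0_finite) (simp add: galois_ring4_def)

lemma of_nat_eq_iff_mod4: "(of_nat m :: 'r) = of_nat n \<longleftrightarrow> m mod 4 = n mod 4"
  using galois by (simp add: of_nat_eq_iff_cong_CHAR cong_def galois_ring4_def)

lemma four_eq_0: "(4::'r) = 0"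
  using of_nat_eq_iff_mod4[of 4 0] by simp

lemma two_neq_0: "(2::'r) \<noteq> 0"
  using of_nat_eq_iff_mod4[of 2 0] by simp

lemma rho_1: "\<rho> 1 = 1" and rho_add: "\<rho> (x + y) = \<rho> x + \<rho> y" and rho_mult: "\<rho> (x * y) = \<rho> x * \<rho> y"
  and surj_rho: "surj \<rho>" and rho_eq_0_iff: "\<rho> x = 0 \<longleftrightarrow> (\<exists>z. x = 2 * z)"
  using residue unfolding residue_map_def by auto

lemma rho_0: "\<rho> 0 = 0"
  by (subst rho_eq_0_iff) (auto intro: exI[of _ 0])

lemma rho_2_mult: "\<rho> (2 * x) = 0"
  by (subst rho_eq_0_iff) auto

lemma rho_diff: "\<rho> (x - y) = \<rho> x - \<rho> y"
  using rho_add[of "x - y" y] by simp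

lemma rho_power: "\<rho> (x ^ n) = \<rho> x ^ n"
  by (induction n) (simp_all add: rho_1 rho_mult)

lemma rho_sum: "\<rho> (sum f A) = (\<Sum>x\<in>A. \<rho> (f x))"
  by (induction A rule: infinite_finite_induct) (simp_all add: rho_0 rho_add)

lemma rho_eqE:
  assumes "\<rho> x = \<rho> y"
  obtains z where "x = y + 2 * z"
  using assms rho_eq_0_iff[of "x - y"] by (auto simp: rho_diff algebra_simps)

lemma four_mult: "2 * (2 * x) = (0::'r)"
proof -
  have "2 * (2 * x) = 4 * x"
    by simp
  thus ?thesis
    unfolding four_eq_0 by simp
qed

text \<open>An element killed by 2 is a zero divisor, hence lies in the ideal generated by 2;
  conversely 4 = 0. Thus \<open>2 * x\<close> depends only on the residue of \<open>x\<close>, which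
  identifies the ideal with \<open>F\<close>.\<close>

lemma two_mult_eq_0_iff: "2 * x = 0 \<longleftrightarrow> \<rho> x = 0"
proof
  assume "2 * x = 0"
  hence "x * 2 = 0"
    by (simp add: mult.commute)
  hence "x \<in> {x. \<exists>y. y \<noteq> 0 \<and> x * y = 0}"
    using two_neq_0 by blast
  also have "\<dots> = range (\<lambda>z. 2 * z)"
    using galois by (simp add: galois_ring4_def)
  finally show "\<rho> x = 0"
    by (auto simp: rho_2_mult)
next
  assume "\<rho> x = 0"
  then obtain z where "x = 2 * z"
    using rho_eq_0_iff by blast
  thus "2 * x = 0"
    using four_mult by simp
qed

lemma two_mult_eq_iff: "2 * x = 2 * y \<longleftrightarrow> \<rho> x = \<rho> y"
  using two_mult_eq_0_iff[of "x - y"] by (simp add: rho_diff right_diff_distrib)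

lemma square_add_2_mult: "(x + 2 * z)\<^sup>2 = (x\<^sup>2 :: 'r)"
proof -
  have "(x + 2 * z)\<^sup>2 = x\<^sup>2 + 2 * (2 * (x * z + z * z))"
    by (simp add: power2_eq_square algebra_simps)
  thus ?thesis
    unfolding four_mult by simp
qed

text \<open>Squaring already forgets multiples of 2, since the mixed term and the square of
  \<open>2 * z\<close> are both divisible by 4.\<close>

lemma power_q_cong:
  assumes "\<rho> x = \<rho> y"
  shows "x ^ 2 ^ r = y ^ 2 ^ r"
proof -
  have "x\<^sup>2 = y\<^sup>2"
    using rho_eqE[OF assms] square_add_2_mult by metis
  thus ?thesis
    unfolding q_eq power_mult by simp
qed

lemma rho_power_q: "\<rho> (x ^ 2 ^ r) = \<rho> x"
  using finite_field_power_card_eq_same[of "\<rho> x"] by (simp add: rho_power card_field)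

subsection \<open>Teichmueller elements\<close>

definition T :: "'r set" where "T = {t. t ^ 2 ^ r = t}"

lemma T_eqI: "x \<in> T \<Longrightarrow> y \<in> T \<Longrightarrow> \<rho> x = \<rho> y \<Longrightarrow> x = y"
  unfolding T_def using power_q_cong[of x y] by simp

text \<open>\<open>x ^ 2 ^ r\<close> and \<open>x\<close> have the same residue, so their powers
  with exponent \<open>2 ^ r\<close> coincide.\<close>

lemma power_q_in_T: "x ^ 2 ^ r \<in> T"
  unfolding T_def using power_q_cong[OF rho_power_q] by simp

lemma T_0: "0 \<in> T" and T_1: "1 \<in> T" and T_mult: "x \<in> T \<Longrightarrow> y \<in> T \<Longrightarrow> x * y \<in> T"
  by (simp_all add: T_def power_mult_distrib power_0_left)

lemma T_power: "x \<in> T \<Longrightarrow> x ^ n \<in> T"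
  by (induction n) (simp_all add: T_1 T_mult)

lemma T_power_q: "x \<in> T \<Longrightarrow> x ^ 2 ^ r = x"
  by (simp add: T_def)

text \<open>Every residue class meets \<open>T\<close> exactly once: the class of \<open>x\<close>
  contains the element \<open>x ^ 2 ^ r\<close> of \<open>T\<close>.\<close>

lemma bij_betw_rho_T: "bij_betw \<rho> T UNIV"
proof -
  have "inj_on \<rho> T"
    by (rule inj_onI) (rule T_eqI)
  moreover have "u \<in> \<rho> ` T" for u
  proof -
    obtain x where "u = \<rho> x"
      using surj_rho by blast
    hence "u = \<rho> (x ^ 2 ^ r)"
      by (simp add: rho_power_q)
    thus ?thesis
      using power_q_in_T by blast
  qed
  ultimately show ?thesis
    unfolding bij_betw_def by blast
qed

lemma card_T: "card T = 2 ^ r"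
  using bij_betw_same_card[OF bij_betw_rho_T] card_field by simp

section \<open>The cyclic subgroup of order 2^r - 1 of the unit group\<close>

text \<open>Multiplication by a unit permutes the set of its powers, so comparing the products over
  this set shows that the exponent annihilates the unit.\<close>

lemma unit_power_card_eq_1:
  fixes \<xi> :: 'r
  assumes "\<xi> dvd 1"
  shows "\<xi> ^ card (range (\<lambda>k::nat. \<xi> ^ k)) = 1"
proof -
  define C where "C = range (\<lambda>k::nat. \<xi> ^ k)"
  obtain \<eta> where \<eta>: "\<eta> * \<xi> = 1"
    using assms by (metis dvdE mult.commute)
  have fin: "finite C"
    using finite_ring by (rule rev_finite_subset) simp
  have inj: "inj_on ((*) \<xi>) C"
    by (rule inj_onI) (metis \<eta> mult.assoc mult_1)
  have "(*) \<xi> ` C \<subseteq> C"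
    unfolding C_def by (auto simp flip: power_Suc)
  hence "(*) \<xi> ` C = C"
    using fin inj by (intro card_subset_eq) (auto simp: card_image)
  hence "prod id C = (\<Prod>x\<in>C. \<xi> * x)"
    using prod.reindex[OF inj, of id] by (simp add: o_def)
  also have "\<dots> = \<xi> ^ card C * prod id C"
    by (simp add: prod.distrib)
  finally have eq: "prod id C = \<xi> ^ card C * prod id C" .
  have "x dvd 1" if "x \<in> C" for x
    using that assms dvd_power_same[of \<xi> 1] unfolding C_def by fastforce
  hence "prod id C dvd prod (\<lambda>_. 1) C"
    by (intro prod_dvd_prod) auto
  hence "prod id C dvd 1"
    by simp
  then obtain p where "prod id C * p = 1"
    by (metis dvdE)
  hence "\<xi> ^ card C = \<xi> ^ card C * prod id C * p"
    by (simp add: mult.assoc)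
  also have "\<dots> = 1"
    using eq \<open>prod id C * p = 1\<close> by simp
  finally show ?thesis
    unfolding C_def .
qed

text \<open>The lift to \<open>T\<close> of a generator of the multiplicative group of
  \<open>F\<close> generates \<open>T - {0}\<close>. Conversely, a unit \<open>\<zeta>\<close> with
  \<open>2 ^ r - 1\<close> powers satisfies \<open>\<zeta> ^ 2 ^ r = \<zeta>\<close>, so its powers
  lie in \<open>T - {0}\<close> and fill it by cardinality.\<close>

lemma teich_group_eq: "teich_group r = T - {0}"
  unfolding teich_group_def
proof (rule the_equality)
  obtain g :: 'f where g: "range (\<lambda>k::nat. g ^ k) = UNIV - {0}"
    by (rule finite_field_generator)
  obtain \<xi> where \<xi>: "\<xi> \<in> T" "\<rho> \<xi> = g"
    using bij_betw_rho_T by (metis UNIV_I bij_betw_imp_surj_on imageE)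
  have powers: "range (\<lambda>k::nat. \<xi> ^ k) = T - {0}"
  proof (intro equalityI subsetI)
    fix x assume "x \<in> range (\<lambda>k::nat. \<xi> ^ k)"
    then obtain k where x: "x = \<xi> ^ k"
      by blast
    have "\<rho> x = g ^ k"
      by (simp add: x rho_power \<xi>)
    hence "\<rho> x \<noteq> 0"
      using g by blast
    thus "x \<in> T - {0}"
      using \<xi> by (auto simp: x T_power rho_0)
  next
    fix x assume x: "x \<in> T - {0}"
    hence "\<rho> x \<noteq> 0"
      using T_eqI[OF _ T_0] rho_0 by auto
    then obtain k where "\<rho> x = g ^ k"
      using g by blast
    hence "x = \<xi> ^ k"
      using x \<xi> by (intro T_eqI) (auto simp: T_power rho_power)
    thus "x \<in> range (\<lambda>k::nat. \<xi> ^ k)"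
      by blast
  qed
  have "\<xi> dvd 1"
  proof -
    have "g \<in> range (\<lambda>k::nat. g ^ k)"
      by (rule range_eqI[of _ _ 1]) simp
    hence "g \<noteq> 0"
      using g by simp
    hence "inverse g \<in> range (\<lambda>k::nat. g ^ k)"
      using g by simp
    then obtain k where k: "inverse g = g ^ k"
      by blast
    have "\<xi> * \<xi> ^ k = 1"
      using \<xi> k \<open>g \<noteq> 0\<close>
      by (intro T_eqI) (auto simp: T_mult T_power T_1 rho_mult rho_power rho_1 simp flip: k)
    thus ?thesis
      by (metis dvd_triv_left)
  qed
  moreover have card: "card (T - {0}) = 2 ^ r - 1"
    using T_0 card_T by simp
  ultimately show "\<exists>\<xi>. \<xi> dvd 1 \<and> T - {0} = range (\<lambda>k::nat. \<xi> ^ k) \<and> card (T - {0}) = 2 ^ r - 1"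
    using powers by blast
  fix C :: "'r set" assume "\<exists>\<xi>. \<xi> dvd 1 \<and> C = range (\<lambda>k::nat. \<xi> ^ k) \<and> card C = 2 ^ r - 1"
  then obtain \<zeta> where \<zeta>: "\<zeta> dvd 1" "C = range (\<lambda>k::nat. \<zeta> ^ k)" "card C = 2 ^ r - 1"
    by blast
  have "\<zeta> ^ (2 ^ r - 1) = 1"
    using unit_power_card_eq_1[OF \<zeta>(1)] \<zeta>(2,3) by simp
  hence "\<zeta> ^ Suc (2 ^ r - 1) = \<zeta>"
    unfolding power_Suc by simp
  hence "\<zeta> \<in> T"
    by (simp add: T_def)
  moreover have "\<zeta> ^ k \<noteq> 0" for k
    using \<zeta>(1) by (metis dvd_power_same dvd_0_left power_one zero_neq_one)
  ultimately have "C \<subseteq> T - {0}"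
    unfolding \<zeta>(2) using T_power by auto
  thus "C = T - {0}"
    using \<zeta>(3) card finite_ring by (intro card_subset_eq) (auto intro: rev_finite_subset)
qed

lemma teich_set_eq: "teich_set r = T"
  using T_0 by (auto simp: teich_set_def teich_group_eq)

abbreviation \<tau> :: "'f \<Rightarrow> 'r" where "\<tau> \<equiv> teich_lift r \<rho>"

lemma tau: "\<tau> u \<in> T" "\<rho> (\<tau> u) = u"
proof -
  have "\<exists>!t. t \<in> T \<and> \<rho> t = u"
    using bij_betw_rho_T T_eqI by (metis UNIV_I bij_betw_imp_surj_on imageE)
  from theI'[OF this] show "\<tau> u \<in> T" "\<rho> (\<tau> u) = u"
    by (simp_all add: teich_lift_def teich_set_eq)
qed

lemma tau_0: "\<tau> 0 = 0"
  by (rule T_eqI) (simp_all add: tau T_0 rho_0)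

text \<open>Here \<open>t\<close> is the square root of \<open>a c\<close> in \<open>T\<close>.\<close>

lemma T_add:
  assumes a: "a \<in> T" and c: "c \<in> T"
  obtains t where "t \<in> T" "a + c + 2 * t \<in> T"
    "\<And>i. (a + c + 2 * t) ^ 2 ^ i = a ^ 2 ^ i + c ^ 2 ^ i + 2 * t ^ 2 ^ i"
proof -
  define t where "t = (a * c) ^ 2 ^ (r - 1)"
  have t: "t \<in> T"
    unfolding t_def using a c by (intro T_power T_mult)
  have "t\<^sup>2 = (a * c) ^ 2 ^ r"
    unfolding t_def q_eq by (simp add: power_mult mult.commute flip: power_mult)
  hence t2: "t\<^sup>2 = a * c"
    using a c by (simp add: T_power_q T_mult)
  have pow: "(a + c + 2 * t) ^ 2 ^ i = a ^ 2 ^ i + c ^ 2 ^ i + 2 * t ^ 2 ^ i" for i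
  proof (induction i)
    case (Suc i)
    have "(a + c + 2 * t) ^ 2 ^ Suc i = ((a + c + 2 * t) ^ 2 ^ i)\<^sup>2"
      by (simp add: mult.commute flip: power_mult)
    also have "\<dots> = (a ^ 2 ^ i + c ^ 2 ^ i)\<^sup>2"
      unfolding Suc by (rule square_add_2_mult)
    \<comment> \<open>The mixed term is a power of \<open>a * c = t\<^sup>2\<close>, which is how
      the next power of \<open>t\<close> arises.\<close>
    also have "\<dots> = (a ^ 2 ^ i)\<^sup>2 + (c ^ 2 ^ i)\<^sup>2 + 2 * (a * c) ^ 2 ^ i"
      by (simp add: power2_sum power_mult_distrib mult.assoc)
    also have "\<dots> = a ^ 2 ^ Suc i + c ^ 2 ^ Suc i + 2 * t ^ 2 ^ Suc i"
      by (simp add: mult.commute flip: t2 power_mult)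
    finally show ?case .
  qed simp
  \<comment> \<open>For \<open>i = r\<close> the elements \<open>a\<close>, \<open>c\<close> and
    \<open>t\<close> are all fixed, hence so is the sum.\<close>
  have "a + c + 2 * t \<in> T"
    using pow[of r] a c t by (simp add: T_def)
  with t pow show ?thesis
    using that by blast
qed

text \<open>A 2-adic expansion: the first digit is the lift of the residue of \<open>x\<close>, and
  the second matters only modulo 2, so it can be lifted as well.\<close>

lemma T_decomp:
  obtains a b where "a \<in> T" "b \<in> T" "x = a + 2 * b"
proof -
  obtain z where z: "x = \<tau> (\<rho> x) + 2 * z"
    using rho_eqE[of x "\<tau> (\<rho> x)"] tau by metis
  have "2 * z = 2 * \<tau> (\<rho> z)"
    by (simp add: two_mult_eq_iff tau)
  with z show ?thesis
    using that tau(1) by metis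
qed

lemma T_decomp_unique:
  assumes "a \<in> T" "b \<in> T" "c \<in> T" "d \<in> T" "a + 2 * b = c + 2 * d"
  shows "a = c" "b = d"
proof -
  have "\<rho> (a + 2 * b) = \<rho> (c + 2 * d)"
    using assms by simp
  hence "\<rho> a = \<rho> c"
    by (simp add: rho_add rho_2_mult)
  thus "a = c"
    using assms T_eqI by blast
  hence "2 * b = 2 * d"
    using assms by simp
  thus "b = d"
    using assms T_eqI by (simp add: two_mult_eq_iff)
qed

subsection \<open>Frobenius and trace\<close>

text \<open>The \<open>i\<close>-th power of the generalized Frobenius map of \<open>R\<close>,
  written with the same choice of digits as \<open>gr_trace\<close> so that the trace unfolds into a
  sum of such values.\<close>

definition frob :: "nat \<Rightarrow> 'r \<Rightarrow> 'r" where
  "frob i x = (let (a, b) = (THE p. fst p \<in> T \<and> snd p \<in> T \<and> x = fst p + 2 * snd p)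
     in a ^ 2 ^ i + 2 * b ^ 2 ^ i)"

lemma the_decomp:
  assumes "a \<in> T" "b \<in> T"
  shows "(THE p. fst p \<in> T \<and> snd p \<in> T \<and> a + 2 * b = fst p + 2 * snd p) = (a, b)"
proof (rule the_equality)
  fix p assume "fst p \<in> T \<and> snd p \<in> T \<and> a + 2 * b = fst p + 2 * snd p"
  thus "p = (a, b)"
    using T_decomp_unique[OF assms, of "fst p" "snd p"] by (simp add: prod_eq_iff)
qed (simp add: assms)

lemma frob_eq: "a \<in> T \<Longrightarrow> b \<in> T \<Longrightarrow> frob i (a + 2 * b) = a ^ 2 ^ i + 2 * b ^ 2 ^ i"
  by (simp add: frob_def the_decomp)

lemma gr_trace_eq: "gr_trace r x = (\<Sum>i<r. frob i x)"
  by (simp add: gr_trace_def frob_def teich_set_eq split_beta)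

text \<open>Up to the factor 2 this is an identity between residues, namely additivity of Frobenius
  in characteristic 2.\<close>

lemma two_frobenius_add: "2 * (x + y) ^ 2 ^ i = 2 * (x ^ 2 ^ i + y ^ 2 ^ i :: 'r)"
proof (induction i)
  case (Suc i)
  have "\<rho> (x + y) ^ 2 ^ i = \<rho> x ^ 2 ^ i + \<rho> y ^ 2 ^ i"
    using Suc unfolding two_mult_eq_iff by (simp add: rho_add rho_power)
  moreover have "(2::'f) = 0"
    using rho_2_mult[of 1] by (metis mult_1_right one_add_one rho_1 rho_add)
  hence "(\<rho> x ^ 2 ^ i + \<rho> y ^ 2 ^ i)\<^sup>2 = (\<rho> x ^ 2 ^ i)\<^sup>2 + (\<rho> y ^ 2 ^ i)\<^sup>2"
    by (simp add: power2_sum)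
  ultimately show ?case
    unfolding two_mult_eq_iff
    by (simp add: rho_add rho_power mult.commute[of "2::nat"] power_mult)
qed simp

text \<open>Addition with carry: since \<open>4 = 0\<close>, \<open>a + c\<close> equals
  \<open>(a + c + 2 * t) + 2 * t\<close>, so the first digit of \<open>x + y\<close> is
  \<open>a + c + 2 * t\<close> and the second is the lift \<open>e\<close> of the residue of
  \<open>t + b + d\<close>. The two copies of \<open>2 * t ^ 2 ^ i\<close> cancel in the
  end.\<close>

lemma frob_add: "frob i (x + y) = frob i x + frob i y"
proof -
  obtain a b where ab: "a \<in> T" "b \<in> T" "x = a + 2 * b"
    by (rule T_decomp)
  obtain c d where cd: "c \<in> T" "d \<in> T" "y = c + 2 * d"
    by (rule T_decomp)
  obtain t where t: "t \<in> T" "a + c + 2 * t \<in> T"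
    "\<And>i. (a + c + 2 * t) ^ 2 ^ i = a ^ 2 ^ i + c ^ 2 ^ i + 2 * t ^ 2 ^ i"
    using T_add[OF ab(1) cd(1)] by metis
  define e where "e = \<tau> (\<rho> (t + (b + d)))"
  have e: "e \<in> T" "\<rho> e = \<rho> (t + (b + d))"
    by (simp_all add: e_def tau)
  have "2 * e ^ 2 ^ i = 2 * (t + (b + d)) ^ 2 ^ i"
    using e by (simp add: two_mult_eq_iff rho_power)
  also have "\<dots> = 2 * t ^ 2 ^ i + 2 * (b + d) ^ 2 ^ i"
    unfolding two_frobenius_add[of t] by (rule distrib_left)
  also have "\<dots> = 2 * t ^ 2 ^ i + (2 * b ^ 2 ^ i + 2 * d ^ 2 ^ i)"
    unfolding two_frobenius_add[of b] by (simp only: distrib_left)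
  finally have e': "2 * e ^ 2 ^ i = 2 * t ^ 2 ^ i + (2 * b ^ 2 ^ i + 2 * d ^ 2 ^ i)" .
  have "2 * e = 2 * (t + (b + d))"
    using e unfolding two_mult_eq_iff by simp
  hence "x + y = (a + c + 2 * t) + 2 * e - 2 * (2 * t)"
    by (simp add: ab cd algebra_simps)
  hence "x + y = (a + c + 2 * t) + 2 * e"
    unfolding four_mult by simp
  hence "frob i (x + y) = (a + c + 2 * t) ^ 2 ^ i + 2 * e ^ 2 ^ i"
    using frob_eq[OF t(2) e(1)] by simp
  also have "\<dots> = (a ^ 2 ^ i + 2 * b ^ 2 ^ i) + (c ^ 2 ^ i + 2 * d ^ 2 ^ i) + 2 * (2 * t ^ 2 ^ i)"
    unfolding t(3) e' by (simp add: algebra_simps)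
  also have "\<dots> = frob i x + frob i y"
    unfolding four_mult using ab cd by (simp add: frob_eq)
  finally show ?thesis .
qed

lemma frob_0: "frob i 0 = 0"
  using frob_add[of i 0 0] by simp

lemma frob_sum: "frob i (sum f A) = (\<Sum>x\<in>A. frob i (f x))"
  by (induction A rule: infinite_finite_induct) (simp_all add: frob_0 frob_add)

lemma frob_1_frob: "frob 1 (frob i x) = frob (Suc i) x"
proof -
  obtain a b where ab: "a \<in> T" "b \<in> T" "x = a + 2 * b"
    by (rule T_decomp)
  hence "frob 1 (frob i x) = (a ^ 2 ^ i) ^ 2 ^ 1 + 2 * (b ^ 2 ^ i) ^ 2 ^ 1"
    by (simp only: frob_eq T_power)
  also have "\<dots> = frob (Suc i) x"
    using ab by (simp add: frob_eq mult.commute[of _ "2::nat"] flip: power_mult)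
  finally show ?thesis .
qed

lemma frob_r: "frob r x = frob 0 x"
proof -
  obtain a b where "a \<in> T" "b \<in> T" "x = a + 2 * b"
    by (rule T_decomp)
  thus ?thesis
    by (simp add: frob_eq T_power_q)
qed

lemma frob_1_trace: "frob 1 (gr_trace r x) = gr_trace r x"
proof -
  \<comment> \<open>Frobenius shifts the summands by one; with \<open>frob 0 x\<close> added, the
    sum runs over \<open>0..r\<close>, and its last term \<open>frob r x\<close> equals
    \<open>frob 0 x\<close>.\<close>
  have "frob 1 (gr_trace r x) + frob 0 x = (\<Sum>i<Suc r. frob i x)"
    unfolding gr_trace_eq frob_sum frob_1_frob by (simp only: sum.lessThan_Suc_shift add.commute)
  thus ?thesis
    by (simp add: gr_trace_eq frob_r)
qed

lemma T_idem:
  assumes "a \<in> T" "a\<^sup>2 = a"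
  shows "a = 0 \<or> a = 1"
proof -
  have "\<rho> a * \<rho> a = \<rho> a"
    using assms(2) by (simp add: power2_eq_square flip: rho_mult)
  hence "\<rho> a = \<rho> 0 \<or> \<rho> a = \<rho> 1"
    by (simp add: rho_0 rho_1)
  thus ?thesis
    using assms T_eqI T_0 T_1 by blast
qed

text \<open>Frobenius fixes the trace, so by uniqueness of digits both digits are idempotents of
  \<open>T\<close>, that is, 0 or 1.\<close>

lemma trace_in_prime_ring: obtains k :: nat where "k < 4" "gr_trace r (x :: 'r) = of_nat k"
proof -
  obtain a b where ab: "a \<in> T" "b \<in> T" "gr_trace r x = a + 2 * b"
    by (rule T_decomp)
  have "a\<^sup>2 + 2 * b\<^sup>2 = a + 2 * b"
    using frob_1_trace[of x] frob_eq[OF ab(1,2), of 1] unfolding ab(3) by simp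
  hence "a\<^sup>2 = a" "b\<^sup>2 = b"
    using T_decomp_unique[of "a\<^sup>2" "b\<^sup>2" a b] ab T_power by simp_all
  hence "a = 0 \<or> a = 1" "b = 0 \<or> b = 1"
    using ab T_idem by blast+
  hence "gr_trace r x = of_nat 0 \<or> gr_trace r x = of_nat 1 \<or> gr_trace r x = of_nat 2 \<or>
    gr_trace r x = of_nat 3"
    using ab(3) by auto
  thus ?thesis
    using that[of 0] that[of 1] that[of 2] that[of 3] by fastforce
qed

lemma trace_add: "gr_trace r (x + y :: 'r) = gr_trace r x + gr_trace r y"
  by (simp add: gr_trace_eq frob_add sum.distrib)

lemma trace_0: "gr_trace r 0 = (0 :: 'r)"
  by (simp add: gr_trace_eq frob_0)

text \<open>The trace of \<open>2 * \<tau> u\<close> is twice an element whose residue is the field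
  trace of \<open>u\<close>, a linearized polynomial with nonzero coefficients.\<close>

lemma trace_two_mult_nonzero: "\<exists>x :: 'r. gr_trace r (2 * x) \<noteq> 0"
proof -
  obtain u :: 'f where u: "(\<Sum>i<r. u ^ 2 ^ i) \<noteq> 0"
    using linearized_poly_eq_0[OF card_field, of "\<lambda>_. 1" 0] r_pos by auto
  have "frob i (2 * \<tau> u) = 2 * \<tau> u ^ 2 ^ i" for i
    using frob_eq[OF T_0 tau(1)] by (simp add: power_0_left)
  hence "gr_trace r (2 * \<tau> u) = 2 * (\<Sum>i<r. \<tau> u ^ 2 ^ i)"
    by (simp add: gr_trace_eq sum_distrib_left)
  also have "\<dots> \<noteq> 0"
    using u by (simp add: two_mult_eq_0_iff rho_sum rho_power tau)
  finally show ?thesis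
    by blast
qed

lemma z4_rep_of_nat: "z4_rep (of_nat k :: 'r) = k mod 4"
  unfolding z4_rep_def by (rule the_equality) (auto simp: of_nat_eq_iff_mod4)

end

section \<open>Gauss sums\<close>

locale galois_character = galois_residue r \<rho>
  for r and \<rho> :: "'r::comm_ring_1 \<Rightarrow> 'f::finite_field" +
  fixes \<omega> :: complex
  assumes primitive: "primitive_root_of_unity 4 \<omega>"
begin

lemma omega_power_mod4: "\<omega> ^ (k mod 4) = \<omega> ^ k"
proof -
  have "\<omega> ^ k = \<omega> ^ (4 * (k div 4) + k mod 4)"
    by simp
  also have "\<dots> = (\<omega> ^ 4) ^ (k div 4) * \<omega> ^ (k mod 4)"
    by (simp only: power_add power_mult)
  finally show ?thesis
    using primitive by (simp add: primitive_root_of_unity_def)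
qed

lemma norm_omega: "cmod \<omega> = 1"
proof -
  have "cmod \<omega> ^ 4 = 1"
    using primitive by (simp add: primitive_root_of_unity_def flip: norm_power)
  thus ?thesis
    using power_eq_1_iff[of "cmod \<omega>" 4] by (auto simp: power_eq_1_iff)
qed

definition psi :: "'r \<Rightarrow> complex" where "psi x = \<omega> ^ z4_rep (gr_trace r x)"

lemma psi_of_nat: "gr_trace r x = of_nat k \<Longrightarrow> psi x = \<omega> ^ k"
  by (simp add: psi_def z4_rep_of_nat omega_power_mod4)

lemma psi_add: "psi (x + y) = psi x * psi y"
proof -
  obtain k where k: "gr_trace r x = of_nat k"
    by (rule trace_in_prime_ring)
  obtain l where l: "gr_trace r y = of_nat l"
    by (rule trace_in_prime_ring)
  have "gr_trace r (x + y) = of_nat (k + l)"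
    by (simp add: trace_add k l)
  from psi_of_nat[OF this] psi_of_nat[OF k] psi_of_nat[OF l] show ?thesis
    by (simp add: power_add)
qed

lemma psi_0: "psi 0 = 1"
  using psi_of_nat[of 0 0] by (simp add: trace_0)

lemma norm_psi: "cmod (psi x) = 1"
  by (simp add: psi_def norm_power norm_omega)

lemma psi_uminus: "psi (- x) = cnj (psi x)"
proof -
  have "psi (- x) * psi x = 1"
    using psi_add[of "- x" x] by (simp add: psi_0)
  moreover have "psi x * cnj (psi x) = 1"
    by (simp add: complex_norm_square[symmetric] norm_psi)
  ultimately show ?thesis
    by (metis mult.assoc mult_1 mult_1_right)
qed

definition chi :: "'f \<Rightarrow> complex" where "chi u = psi (2 * \<tau> u)"

lemma psi_two_mult: "psi (2 * x) = chi (\<rho> x)"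
proof -
  have "2 * x = 2 * \<tau> (\<rho> x)"
    by (simp add: two_mult_eq_iff tau)
  thus ?thesis
    by (simp add: chi_def)
qed

lemma chi_add: "chi (u + v) = chi u * chi v"
proof -
  have "chi u * chi v = psi (2 * (\<tau> u + \<tau> v))"
    by (simp add: chi_def distrib_left psi_add)
  thus ?thesis
    unfolding psi_two_mult by (simp add: rho_add tau)
qed

lemma chi_nontrivial: "\<exists>u. chi u \<noteq> 1"
proof -
  obtain x :: 'r where x: "gr_trace r (2 * x) \<noteq> 0"
    using trace_two_mult_nonzero by blast
  obtain k where k: "k < 4" "gr_trace r (2 * x) = of_nat k"
    by (rule trace_in_prime_ring)
  have "0 < k"
    using x k by (cases k) auto
  hence "psi (2 * x) \<noteq> 1"
    using primitive k psi_of_nat[OF k(2)] by (simp add: primitive_root_of_unity_def)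
  thus ?thesis
    unfolding psi_two_mult by blast
qed

text \<open>Translation by some \<open>v\<close> with \<open>chi v \<noteq> 1\<close> preserves the
  sum but multiplies it by \<open>chi v\<close>.\<close>

lemma sum_chi: "(\<Sum>u\<in>UNIV. chi u) = 0"
proof -
  obtain v where v: "chi v \<noteq> 1"
    using chi_nontrivial by blast
  have "(\<Sum>u\<in>UNIV. chi u) = (\<Sum>u\<in>UNIV. chi (v + u))"
    by (rule sum.reindex_bij_witness[of _ "\<lambda>u. v + u" "\<lambda>u. u - v"]) auto
  also have "\<dots> = chi v * (\<Sum>u\<in>UNIV. chi u)"
    by (simp add: chi_add sum_distrib_left)
  finally show ?thesis
    using v by simp
qed

lemma sum_chi_bij:
  fixes h :: "'f \<Rightarrow> 'f"
  assumes "inj h"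
  shows "(\<Sum>u\<in>UNIV. chi (h u)) = 0"
proof -
  have "bij h"
    using assms by (simp add: bij_def finite_UNIV_inj_surj[OF finite])
  thus ?thesis
    using sum.reindex_bij_betw[of h UNIV UNIV chi] sum_chi by simp
qed

text \<open>Orthogonality of characters. It settles two vectors of the same basis, for which the
  quadratic terms cancel.\<close>

lemma sum_psi_two_mult:
  "(\<Sum>w\<in>UNIV. psi (2 * \<tau> w * c)) = (if \<rho> c = 0 then of_nat (2 ^ r) else 0)"
proof -
  have "(\<Sum>w\<in>UNIV. psi (2 * \<tau> w * c)) = (\<Sum>w\<in>UNIV. chi (w * \<rho> c))"
    by (simp add: mult.assoc psi_two_mult rho_mult tau)
  moreover have "chi 0 = 1"
    by (simp add: chi_def tau_0 psi_0)
  moreover have "inj (\<lambda>w. w * \<rho> c)" if "\<rho> c \<noteq> 0"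
    using that by (simp add: inj_def)
  ultimately show ?thesis
    using sum_chi_bij by (auto simp: card_field)
qed

end

section \<open>The quadratic form of the presemifield\<close>

locale mub_construction = galois_character r \<rho> \<omega>
  for r and \<rho> :: "'r::comm_ring_1 \<Rightarrow> 'f::finite_field" and \<omega> +
  fixes star :: "'f \<Rightarrow> 'f \<Rightarrow> 'f" and a :: "nat \<Rightarrow> nat \<Rightarrow> 'f"
  assumes presemifield: "commutative_presemifield star"
    and star_eq: "star x y = (\<Sum>i<r. \<Sum>j<r. a i j * x ^ (2 ^ i) * y ^ (2 ^ j))"
begin

abbreviation E :: "'r \<Rightarrow> 'r \<Rightarrow> 'r" where "E \<equiv> ext_mult r \<rho> a"

lemma star_add_right: "star x (y + z) = star x y + star x z"
  and star_eq_0: "star x y = 0 \<Longrightarrow> x = 0 \<or> y = 0"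
  and star_commute: "star x y = star y x"
  using presemifield unfolding commutative_presemifield_def presemifield_def by simp_all

lemma star_0_left: "star 0 y = 0"
  by (simp add: star_eq power_0_left)

lemma coefficients_symmetric:
  assumes "i < r" "j < r"
  shows "a i j = a j i"
proof -
  \<comment> \<open>The difference \<open>star x y - star y x\<close> as a linearized polynomial in
    \<open>x\<close> whose coefficients are linearized polynomials in \<open>y\<close>; uniqueness
    of coefficients is then applied twice.\<close>
  have *: "(\<Sum>i<r. (\<Sum>j<r. (a i j - a j i) * y ^ 2 ^ j) * x ^ 2 ^ i) = 0" for x y
  proof -
    have "(\<Sum>i<r. (\<Sum>j<r. (a i j - a j i) * y ^ 2 ^ j) * x ^ 2 ^ i) =
      star x y - (\<Sum>i<r. \<Sum>j<r. a j i * y ^ 2 ^ j * x ^ 2 ^ i)"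
      unfolding star_eq by (simp add: sum_distrib_left sum_distrib_right left_diff_distrib
          right_diff_distrib sum_subtractf mult_ac)
    also have "(\<Sum>i<r. \<Sum>j<r. a j i * y ^ 2 ^ j * x ^ 2 ^ i) = star y x"
      unfolding star_eq by (rule sum.swap)
    finally show ?thesis
      by (simp add: star_commute)
  qed
  have "(\<Sum>j<r. (a i j - a j i) * y ^ 2 ^ j) = 0" for y
    using linearized_poly_eq_0[OF card_field * \<open>i < r\<close>] .
  from linearized_poly_eq_0[OF card_field this \<open>j < r\<close>] show ?thesis
    by simp
qed

lemma rho_ext_mult: "\<rho> (E x y) = star (\<rho> x) (\<rho> y)"
  by (simp add: ext_mult_def star_eq rho_sum rho_mult rho_power tau)

text \<open>The symmetry of the coefficients makes the two mixed terms equal in \<open>R\<close> and not merely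
  modulo 2; the contributions of the Teichmueller correction then carry a factor 4.\<close>

lemma ext_mult_tau_add:
  "E (\<tau> (w + z)) (\<tau> (w + z)) = E (\<tau> w) (\<tau> w) + E (\<tau> z) (\<tau> z) + 2 * E (\<tau> w) (\<tau> z)"
proof -
  \<comment> \<open>Arbitrary sequences replace the powers of \<open>x\<close> and \<open>y\<close>:
    \<open>B\<close> is bilinear in them, whereas \<open>E\<close> need not be additive on
    \<open>R\<close>.\<close>
  define B :: "(nat \<Rightarrow> 'r) \<Rightarrow> (nat \<Rightarrow> 'r) \<Rightarrow> 'r"
    where "B p s = (\<Sum>i<r. \<Sum>j<r. \<tau> (a i j) * p i * s j)" for p s
  have E: "E x y = B (\<lambda>i. x ^ 2 ^ i) (\<lambda>i. y ^ 2 ^ i)" for x y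
    by (simp add: ext_mult_def B_def)
  have comm: "B p s = B s p" for p s
  proof -
    have "B p s = (\<Sum>j<r. \<Sum>i<r. \<tau> (a i j) * p i * s j)"
      unfolding B_def by (rule sum.swap)
    also have "\<dots> = B s p"
      unfolding B_def
      by (intro sum.cong) (auto simp: mult_ac intro!: arg_cong2[of _ _ _ _ "(*)"] coefficients_symmetric
          arg_cong[of _ _ \<tau>])
    finally show ?thesis .
  qed
  have add: "B (\<lambda>i. p i + s i) u = B p u + B s u" for p s u
    by (simp add: B_def algebra_simps sum.distrib)
  have two: "B (\<lambda>i. 2 * p i) u = 2 * B p u" for p u
    by (simp add: B_def sum_distrib_left mult_ac)
  have square: "B (\<lambda>i. p i + s i) (\<lambda>i. p i + s i) = B p p + B s s + 2 * B p s" for p s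
    by (simp add: add comm[of _ "\<lambda>i. p i + s i"] comm[of s p])
  obtain t where t: "t \<in> T" "\<tau> w + \<tau> z + 2 * t \<in> T"
    "\<And>i. (\<tau> w + \<tau> z + 2 * t) ^ 2 ^ i = \<tau> w ^ 2 ^ i + \<tau> z ^ 2 ^ i + 2 * t ^ 2 ^ i"
    using T_add[OF tau(1)[of w] tau(1)[of z]] by metis
  have "\<tau> (w + z) = \<tau> w + \<tau> z + 2 * t"
    using t(2) by (intro T_eqI) (simp_all add: tau rho_add rho_2_mult)
  hence "E (\<tau> (w + z)) (\<tau> (w + z)) =
      B (\<lambda>i. (\<tau> w ^ 2 ^ i + \<tau> z ^ 2 ^ i) + 2 * t ^ 2 ^ i) (\<lambda>i. (\<tau> w ^ 2 ^ i + \<tau> z ^ 2 ^ i) + 2 * t ^ 2 ^ i)"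
    by (simp only: E t(3))
  also have "\<dots> = B (\<lambda>i. \<tau> w ^ 2 ^ i + \<tau> z ^ 2 ^ i) (\<lambda>i. \<tau> w ^ 2 ^ i + \<tau> z ^ 2 ^ i)"
    unfolding square[of "\<lambda>i. \<tau> w ^ 2 ^ i + \<tau> z ^ 2 ^ i"]
      comm[of "\<lambda>i. \<tau> w ^ 2 ^ i + \<tau> z ^ 2 ^ i" "\<lambda>i. 2 * t ^ 2 ^ i"] two
      comm[of "\<lambda>i. t ^ 2 ^ i" "\<lambda>i. 2 * t ^ 2 ^ i"] four_mult
    by simp
  also have "\<dots> = E (\<tau> w) (\<tau> w) + E (\<tau> z) (\<tau> z) + 2 * E (\<tau> w) (\<tau> z)"
    unfolding square E ..
  finally show ?thesis .
qed

text \<open>\<open>D\<close> and \<open>c\<close> range over \<open>R\<close>, as differences of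
  Teichmueller elements need not lie in \<open>T\<close>.\<close>

definition phi :: "'r \<Rightarrow> 'r \<Rightarrow> 'f \<Rightarrow> complex" where
  "phi D c w = psi (D * E (\<tau> w) (\<tau> w) + 2 * \<tau> w * c)"

lemma phi_add: "phi D c (w + z) = phi D c w * phi D c z * chi (\<rho> D * star w z)"
proof -
  \<comment> \<open>\<open>\<tau>\<close> is additive modulo 2, which suffices in front of the
    factor 2.\<close>
  have "2 * \<tau> (w + z) = 2 * (\<tau> w + \<tau> z)"
    unfolding two_mult_eq_iff by (simp add: tau rho_add)
  hence "D * E (\<tau> (w + z)) (\<tau> (w + z)) + 2 * \<tau> (w + z) * c =
    (D * E (\<tau> w) (\<tau> w) + 2 * \<tau> w * c) + (D * E (\<tau> z) (\<tau> z) + 2 * \<tau> z * c) +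
    2 * (D * E (\<tau> w) (\<tau> z))"
    unfolding ext_mult_tau_add by (simp add: algebra_simps)
  thus ?thesis
    unfolding phi_def by (simp only: psi_add psi_two_mult rho_mult rho_ext_mult tau)
qed

lemma norm_gauss_sum:
  assumes D: "\<rho> D \<noteq> 0"
  shows "(cmod (\<Sum>w\<in>UNIV. phi D c w))\<^sup>2 = 2 ^ r"
proof -
  define S where "S = (\<Sum>w\<in>UNIV. phi D c w)"
  have norm: "phi D c z * cnj (phi D c z) = 1" for z
    by (simp add: complex_norm_square[symmetric] phi_def norm_psi)
  have inj: "inj (\<lambda>z. \<rho> D * star w z)" if "w \<noteq> 0" for w
  proof (rule injI)
    fix y z assume "\<rho> D * star w y = \<rho> D * star w z"
    hence "star w y = star w z"
      using D by simp
    hence "star w (y - z) = 0"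
      using star_add_right[of w "y - z" z] by simp
    thus "y = z"
      using star_eq_0 \<open>w \<noteq> 0\<close> by fastforce
  qed
  have chi_0: "chi 0 = 1"
    by (simp add: chi_def tau_0 psi_0)
  have shift: "(\<Sum>w\<in>UNIV. f w) = (\<Sum>w\<in>UNIV. f (w + z))" for f :: "'f \<Rightarrow> complex" and z
    by (rule sum.reindex_bij_witness[of _ "\<lambda>w. w + z" "\<lambda>w. w - z"]) auto
  have "S * cnj S = (\<Sum>z\<in>UNIV. \<Sum>w\<in>UNIV. phi D c w * cnj (phi D c z))"
    unfolding S_def by (simp add: sum_product) (rule sum.swap)
  also have "\<dots> = (\<Sum>z\<in>UNIV. \<Sum>w\<in>UNIV. phi D c (w + z) * cnj (phi D c z))"
    by (rule sum.cong) (rule refl, rule shift)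
  \<comment> \<open>After the shift by \<open>z\<close>, the factor \<open>phi D c z\<close> of
    \<open>phi D c (w + z)\<close> cancels against its conjugate.\<close>
  also have "\<dots> = (\<Sum>z\<in>UNIV. \<Sum>w\<in>UNIV. phi D c w * chi (\<rho> D * star w z))"
  proof (intro sum.cong refl)
    fix z w
    have "phi D c (w + z) * cnj (phi D c z) =
      phi D c w * chi (\<rho> D * star w z) * (phi D c z * cnj (phi D c z))"
      by (simp add: phi_add mult_ac)
    thus "phi D c (w + z) * cnj (phi D c z) = phi D c w * chi (\<rho> D * star w z)"
      by (simp add: norm)
  qed
  also have "\<dots> = (\<Sum>w\<in>UNIV. phi D c w * (\<Sum>z\<in>UNIV. chi (\<rho> D * star w z)))"
    unfolding sum_distrib_left by (rule sum.swap)
  also have "\<dots> = (\<Sum>w\<in>UNIV. if w = 0 then phi D c w * of_nat (2 ^ r) else 0)"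
    by (intro sum.cong refl) (auto simp: sum_chi_bij inj star_0_left chi_0 card_field)
  also have "\<dots> = of_nat (2 ^ r)"
    by (simp add: phi_def tau_0 ext_mult_def power_0_left psi_0)
  finally have "complex_of_real ((cmod S)\<^sup>2) = complex_of_real (2 ^ r)"
    unfolding complex_norm_square by simp
  thus ?thesis
    unfolding S_def of_real_eq_iff .
qed

section \<open>Inner products of the basis vectors\<close>

abbreviation "b \<equiv> mub_vec r \<rho> a \<omega>"

lemma mub_vec_nth: "b m v $ w = complex_of_real (1 / sqrt (2 ^ r)) * phi (\<tau> m) (\<tau> v) w"
proof -
  have "(\<Sum>u\<in>UNIV. (g u *s axis u 1 :: complex ^ 'f::finite_field)) $ w = g w" for g
  proof -
    have "(\<Sum>u\<in>UNIV. (g u *s axis u 1 :: complex ^ 'f::finite_field)) $ w = (\<Sum>u\<in>UNIV. if u = w then g u else 0)"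
      unfolding sum_component by (intro sum.cong) (auto simp: axis_def)
    thus ?thesis
      by simp
  qed
  thus ?thesis
    by (simp add: mub_vec_def phi_def psi_def card_field)
qed

text \<open>Conjugation negates the argument of \<open>psi\<close>, so a product of coordinates is
  again a value of \<open>phi\<close>, at the differences of the lifts.\<close>

lemma cinner_mub_vec:
  "cinner (b m v) (b m' v') = (\<Sum>w\<in>UNIV. phi (\<tau> m - \<tau> m') (\<tau> v - \<tau> v') w) / 2 ^ r"
proof -
  have phi: "phi (\<tau> m) (\<tau> v) w * cnj (phi (\<tau> m') (\<tau> v') w) = phi (\<tau> m - \<tau> m') (\<tau> v - \<tau> v') w" for w
    unfolding phi_def psi_uminus[symmetric] psi_add[symmetric] by (simp add: algebra_simps)
  have "complex_of_real (1 / sqrt (2 ^ r)) * complex_of_real (1 / sqrt (2 ^ r)) = 1 / 2 ^ r"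
    unfolding of_real_mult[symmetric] by (simp add: real_sqrt_mult_self)
  hence "b m v $ w * cnj (b m' v' $ w) = phi (\<tau> m - \<tau> m') (\<tau> v - \<tau> v') w / 2 ^ r" for w
    unfolding mub_vec_nth complex_cnj_mult complex_cnj_complex_of_real phi[symmetric]
    by (simp add: mult_ac)
  thus ?thesis
    by (simp add: cinner_def sum_divide_distrib)
qed

lemma cinner_mub_vec_same: "cinner (b m v) (b m v') = (if v = v' then 1 else 0)"
  unfolding cinner_mub_vec by (simp add: phi_def sum_psi_two_mult rho_diff tau)

lemma norm_cinner_mub_vec:
  assumes "m \<noteq> m'"
  shows "(cmod (cinner (b m v) (b m' v')))\<^sup>2 = 1 / 2 ^ r"
proof -
  have "(cmod (cinner (b m v) (b m' v')))\<^sup>2 = 2 ^ r / (2 ^ r)\<^sup>2"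
    using assms
    by (simp add: cinner_mub_vec norm_divide norm_power power_divide norm_gauss_sum rho_diff tau)
  thus ?thesis
    by (simp add: power2_eq_square)
qed

lemma norm_cinner_mub_vec_axis: "(cmod (cinner (b m v) (axis w 1)))\<^sup>2 = 1 / 2 ^ r"
  by (simp add: cinner_axis_right mub_vec_nth norm_mult norm_divide power_divide phi_def norm_psi)

lemma mubs: "complete_mubs (insert std_basis (range (mub_basis r \<rho> a \<omega>)))"
proof -
  define q where "q = (2 ^ r :: real)"
  have "q > 1"
    using r_pos by (simp add: q_def)
  have norm_commute: "(cmod (cinner x y))\<^sup>2 = (cmod (cinner y x))\<^sup>2" for x y :: "complex ^ 'f::finite_field"
    by (subst cinner_commute) simp
  have mub: "(cmod (cinner x y))\<^sup>2 = 1 / q" "(cmod (cinner y x))\<^sup>2 = 1 / q"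
    if "x \<in> mub_basis r \<rho> a \<omega> m" "y \<in> mub_basis r \<rho> a \<omega> m'" "m \<noteq> m'" for x y m m'
    using that norm_cinner_mub_vec by (auto simp: mub_basis_def q_def)
  have std: "(cmod (cinner x y))\<^sup>2 = 1 / q" "(cmod (cinner y x))\<^sup>2 = 1 / q"
    if "x \<in> mub_basis r \<rho> a \<omega> m" "y \<in> std_basis" for x y m
    using that norm_cinner_mub_vec_axis norm_commute[of y x]
    by (auto simp: mub_basis_def std_basis_def q_def)
  \<comment> \<open>A vector common to two of the bases would have squared inner product
    \<open>1 / q\<close> with itself instead of 1. Hence the bases are distinct and their number is
    exactly \<open>CARD('f) + 1\<close>.\<close>
  have one: "(cmod (cinner (b m 0) (b m 0)))\<^sup>2 \<noteq> 1 / q" for m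
    using \<open>q > 1\<close> by (simp add: cinner_mub_vec_same)
  have mem: "b m 0 \<in> mub_basis r \<rho> a \<omega> m" for m
    by (simp add: mub_basis_def)
  have "inj (mub_basis r \<rho> a \<omega>)"
    by (rule injI) (metis mub(1) mem one)
  moreover have "std_basis \<notin> range (mub_basis r \<rho> a \<omega>)"
    by (metis std(1) mem one imageE)
  ultimately have "card (insert std_basis (range (mub_basis r \<rho> a \<omega>))) = CARD('f) + 1"
    by (simp add: card_image)
  moreover have "orthonormal_basis (std_basis :: (complex ^ 'f::finite_field) set)"
    unfolding std_basis_def
    by (rule orthonormal_basis_range) (subst cinner_axis_right, simp add: axis_def)
  moreover have "orthonormal_basis (mub_basis r \<rho> a \<omega> m)" for m
    unfolding mub_basis_def by (rule orthonormal_basis_range) (rule cinner_mub_vec_same)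
  moreover have "(cmod (cinner x y))\<^sup>2 = 1 / q"
    if "B \<in> insert std_basis (range (mub_basis r \<rho> a \<omega>))"
      "B' \<in> insert std_basis (range (mub_basis r \<rho> a \<omega>))" "B \<noteq> B'" "x \<in> B" "y \<in> B'" for B B' x y
    using that mub std by blast
  ultimately show ?thesis
    unfolding complete_mubs_def q_def by (auto simp: card_field)
qed

end

theorem theorem4p3:
  fixes r :: nat
    and star :: "'f::finite_field \<Rightarrow> 'f \<Rightarrow> 'f"
    and a :: "nat \<Rightarrow> nat \<Rightarrow> 'f"
    and \<rho> :: "'r::comm_ring_1 \<Rightarrow> 'f"
    and \<omega> :: complex
  assumes "CARD('f) = 2 ^ r"
    and "commutative_presemifield star"
    and "\<And>x y. star x y = (\<Sum>i<r. \<Sum>j<r. a i j * x ^ (2 ^ i) * y ^ (2 ^ j))"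
    and "galois_ring4 TYPE('r) r"
    and "residue_map \<rho>"
    and "primitive_root_of_unity 4 \<omega>"
  shows "complete_mubs (insert std_basis (range (mub_basis r \<rho> a \<omega>)))"
proof -
  interpret mub_construction r \<rho> \<omega> star a
    by unfold_locales (fact assms)+
  show ?thesis
    by (rule mubs)
qed

end
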